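(* Let $V$ and $W$ be real vector spaces of the same finite dimension, let $f\colon V\to W$ be linear, let $\ell\in V^*$ satisfy $\ell|_{\operatorname{Ker} f}=0$, and let $b\in\operatorname{Im} f$. Choose $a\in V$ with $f(a)=b$. Then the function $g\mapsto \ell(g^{-1}b)$, defined on the open set of invertible linear maps $g\colon V\to W$ in $\operatorname{Hom}(V,W)$, satisfies $$\operatorname*{ap-lim}_{g\to f}\ell(g^{-1}b)=\ell(a).$$ Moreover, the right-hand side is independent of the choice of $a$ with $f(a)=b$.
   Context: $\operatorname{Hom}(V,W)$ is identified with a Euclidean space by choosing bases of $V$ and $W$; the notions below do not depend on this choice. A measurable subset $A$ of a Euclidean space $E$ has density one at $x_0\in E$ if $\lim_{r\to0^+}\mathrm{vol}(A\cap B_r(x_0))/\mathrm{vol}(B_r(x_0))=1$, where $\mathrm{vol}$ is Lebesgue measure and $B_r(x_0)$ is the open ball of radius $r$ centred at $x_0$ (for zero-dimensional $E$, $\mathrm{vol}$ is the unit point mass). For a measurable real-valued function $h$ defined almost everywhere near $x_0$, $\operatorname*{ap-lim}_{x\to x_0}h(x)=c$ means that for every $\varepsilon>0$ the set of $x$ in the domain of $h$ with $|h(x)-c|<\varepsilon$ has density one at $x_0$. *)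

theory Defs
  imports "HOL-Analysis.Analysis"
begin

text \<open>
  Euclidean space with coordinates indexed by a finite set \<open>I\<close> is the set of extensional
  functions \<open>I \<rightarrow>\<^sub>E UNIV\<close>. In contrast to the class \<open>euclidean_space\<close> this includes dimension
  zero: for \<open>I = {}\<close> the space is a single point, and the (empty) product measure is the
  unit point mass on it.
\<close>

definition coord_lebesgue :: "'i set \<Rightarrow> ('i \<Rightarrow> real) measure"
  where "coord_lebesgue I = completion (Pi\<^sub>M I (\<lambda>_. lborel))"

definition coord_ball :: "'i set \<Rightarrow> ('i \<Rightarrow> real) \<Rightarrow> real \<Rightarrow> ('i \<Rightarrow> real) set"
  where "coord_ball I x0 r = {x \<in> I \<rightarrow>\<^sub>E UNIV. L2_set (\<lambda>i. x i - x0 i) I < r}"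

definition density_one :: "'i set \<Rightarrow> ('i \<Rightarrow> real) set \<Rightarrow> ('i \<Rightarrow> real) \<Rightarrow> bool"
  where "density_one I A x0 \<longleftrightarrow>
    A \<in> sets (coord_lebesgue I) \<and>
    ((\<lambda>r. measure (coord_lebesgue I) (A \<inter> coord_ball I x0 r)
          / measure (coord_lebesgue I) (coord_ball I x0 r)) \<longlongrightarrow> 1) (at_right 0)"

text \<open>
  A partial function is given by its domain \<open>D\<close> and a total function \<open>h\<close>, whose values
  outside \<open>D\<close> are irrelevant. The first three conjuncts say that it is a measurable function
  defined almost everywhere near \<open>x0\<close>.
\<close>

definition ap_lim ::
  "'i set \<Rightarrow> ('i \<Rightarrow> real) set \<Rightarrow> (('i \<Rightarrow> real) \<Rightarrow> real) \<Rightarrow> ('i \<Rightarrow> real) \<Rightarrow> real \<Rightarrow> bool"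
  where "ap_lim I D h x0 c \<longleftrightarrow>
    D \<in> sets (coord_lebesgue I) \<and>
    h \<in> borel_measurable (restrict_space (coord_lebesgue I) D) \<and>
    (\<exists>r>0. AE x in coord_lebesgue I. x \<in> coord_ball I x0 r \<longrightarrow> x \<in> D) \<and>
    (\<forall>\<epsilon>>0. density_one I {x \<in> D. \<bar>h x - c\<bar> < \<epsilon>} x0)"

definition is_basis :: "'v::real_vector set \<Rightarrow> bool"
  where "is_basis B \<longleftrightarrow> independent B \<and> span B = UNIV"

text \<open>
  Matrix entries of a linear map with respect to bases \<open>B\<close> of the source and \<open>C\<close> of the target.
\<close>

definition hom_coords ::
  "'v::real_vector set \<Rightarrow> 'w::real_vector set \<Rightarrow> ('v \<Rightarrow> 'w) \<Rightarrow> ('v \<times> 'w \<Rightarrow> real)"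
  where "hom_coords B C g = (\<lambda>(v, w) \<in> B \<times> C. representation C (g v) w)"

lemma hom_coords_bij_betw:
  fixes B :: "'v::real_vector set" and C :: "'w::real_vector set"
  assumes B: "is_basis B" and C: "is_basis C" and finC: "finite C"
  shows "bij_betw (hom_coords B C) {g. linear g} (B \<times> C \<rightarrow>\<^sub>E UNIV)"
proof (rule bij_betw_imageI)
  have iB: "independent B" and sB: "span B = UNIV" and iC: "independent C" and sC: "span C = UNIV"
    using B C by (auto simp: is_basis_def)
  have exp: "(\<Sum>w\<in>C. representation C y w *\<^sub>R w) = y" for y
    using real_vector.sum_representation_eq[OF iC _ finC order_refl, of y] sC by simp
  show "inj_on (hom_coords B C) {g. linear g}"
  proof (rule inj_onI, unfold mem_Collect_eq)
    fix g h :: "'v \<Rightarrow> 'w"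
    assume lin: "linear g" "linear h" and eq: "hom_coords B C g = hom_coords B C h"
    have "g v = h v" if v: "v \<in> B" for v
    proof -
      have "representation C (g v) w = representation C (h v) w" if "w \<in> C" for w
        using fun_cong[OF eq, of "(v, w)"] v that by (simp add: hom_coords_def)
      then have "(\<Sum>w\<in>C. representation C (g v) w *\<^sub>R w) = (\<Sum>w\<in>C. representation C (h v) w *\<^sub>R w)"
        by simp
      then show ?thesis by (simp add: exp)
    qed
    then show "g = h"
      using linear_eq_on_span[OF lin, of B] sB by (metis UNIV_I ext)
  qed
  show "hom_coords B C ` {g. linear g} = (B \<times> C \<rightarrow>\<^sub>E UNIV)"
  proof (intro equalityI subsetI)
    fix x :: "'v \<times> 'w \<Rightarrow> real" assume x: "x \<in> B \<times> C \<rightarrow>\<^sub>E UNIV"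
    obtain g where g: "linear g" "\<forall>v\<in>B. g v = (\<Sum>w\<in>C. x (v, w) *\<^sub>R w)"
      using linear_independent_extend[OF iB, of "\<lambda>v. \<Sum>w\<in>C. x (v, w) *\<^sub>R w"] by auto
    have rep: "representation C (\<Sum>w\<in>C. x (v, w) *\<^sub>R w) w' = x (v, w')" if "w' \<in> C" for v w'
    proof -
      have "(\<Sum>w\<in>C. (representation C (\<Sum>w\<in>C. x (v, w) *\<^sub>R w) w - x (v, w)) *\<^sub>R w) = 0"
        by (simp only: scaleR_diff_left sum_subtractf exp diff_self)
      from real_vector.independentD[OF iC finC order_refl this that] show ?thesis by simp
    qed
    have "hom_coords B C g = x"
    proof
      fix p :: "'v \<times> 'w"
      show "hom_coords B C g p = x p"
      proof (cases "p \<in> B \<times> C")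
        case True
        then obtain v w where p: "p = (v, w)" "v \<in> B" "w \<in> C" by blast
        with g(2) show ?thesis by (simp add: hom_coords_def rep)
      next
        case False
        then show ?thesis using PiE_arb[OF x False] by (simp add: hom_coords_def restrict_def)
      qed
    qed
    then show "x \<in> hom_coords B C ` {g. linear g}" using g by blast
  next
    fix x assume "x \<in> hom_coords B C ` {g. linear g}"
    then show "x \<in> B \<times> C \<rightarrow>\<^sub>E UNIV" unfolding hom_coords_def by (elim imageE) simp
  qed
qed

text \<open>
  Approximate limit of a function on \<open>D \<subseteq> Hom(V, W)\<close>, where \<open>Hom(V, W)\<close> is identified with
  the Euclidean space of matrices by \<open>hom_coords\<close>. Since the notion does not depend on the bases,
  it is required for every choice of them.
\<close>

definition hom_ap_lim ::
  "('v::real_vector \<Rightarrow> 'w::real_vector) set \<Rightarrow> (('v \<Rightarrow> 'w) \<Rightarrow> real) \<Rightarrow> ('v \<Rightarrow> 'w) \<Rightarrow> real \<Rightarrow> bool"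
  where "hom_ap_lim D h f c \<longleftrightarrow>
    (\<forall>B C. is_basis B \<longrightarrow> is_basis C \<longrightarrow>
      ap_lim (B \<times> C) (hom_coords B C ` D)
        (\<lambda>x. h (the_inv_into {g. linear g} (hom_coords B C) x)) (hom_coords B C f) c)"

end

theory Submission
  imports Defs "Jordan_Normal_Form.Determinant"
begin

text \<open>
  Since \<open>l\<close> vanishes on the kernel of \<open>f\<close>, it factors as \<open>l = m \<circ> f\<close>. Writing \<open>g = f + X\<close> one finds
  \<open>l (g\<^sup>-\<^sup>1 b) - l a = m (X (g\<^sup>-\<^sup>1 (X a))) - m (X a)\<close>, which is \<open>O(r + r\<^sup>2 \<bar>g\<^sup>-\<^sup>1\<bar>)\<close> on the ball of radius
  \<open>r\<close> about \<open>f\<close>. So it suffices that the entries of \<open>g\<^sup>-\<^sup>1\<close> are at most \<open>\<delta> / r\<^sup>2\<close> off a set of small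
  relative measure. By Cramer's rule an entry of \<open>g\<^sup>-\<^sup>1\<close> is a cofactor divided by the determinant; as a
  function of the corresponding entry \<open>t\<close> of \<open>g\<close> it is \<open>0\<close> or \<open>1 / (t - c)\<close>, so it exceeds \<open>M\<close> only
  on an interval of length \<open>2 / M\<close>. With \<open>M = \<delta> / r\<^sup>2\<close> and Fubini, the exceptional set has measure
  \<open>O(r\<^bsup>N+1\<^esup>)\<close>, where \<open>N\<close> is the dimension of \<open>Hom(V, W)\<close>.
\<close>

text \<open>\<open>HOL-Algebra\<close> turns \<open>inv\<close> into a keyword, which hides the inverse function.\<close>

unbundle no m_inv_syntax

subsection \<open>Determinants and cofactors as functions of the entries\<close>

lemma borel_measurable_det:
  fixes A :: "'a \<Rightarrow> real mat"
  assumes A: "\<And>x. A x \<in> carrier_mat n n"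
    and m: "\<And>i j. i < n \<Longrightarrow> j < n \<Longrightarrow> (\<lambda>x. A x $$ (i, j)) \<in> borel_measurable M"
  shows "(\<lambda>x. det (A x)) \<in> borel_measurable M"
  unfolding det_def'[OF A]
proof (intro borel_measurable_sum borel_measurable_times borel_measurable_const borel_measurable_prod)
  fix p i assume "p \<in> {p. p permutes {0..<n}}" and "i \<in> {0..<n}"
  then have "i < n" "p i < n" using permutes_in_image[of p "{0..<n}" i] by auto
  then show "(\<lambda>x. A x $$ (i, p i)) \<in> borel_measurable M" by (rule m)
qed

lemma borel_measurable_cofactor:
  fixes A :: "'a \<Rightarrow> real mat"
  assumes A: "\<And>x. A x \<in> carrier_mat n n"
    and m: "\<And>i j. i < n \<Longrightarrow> j < n \<Longrightarrow> (\<lambda>x. A x $$ (i, j)) \<in> borel_measurable M"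
  shows "(\<lambda>x. cofactor (A x) i j) \<in> borel_measurable M"
proof -
  have "(\<lambda>x. det (mat_delete (A x) i j)) \<in> borel_measurable M"
  proof (rule borel_measurable_det)
    show "mat_delete (A x) i j \<in> carrier_mat (n - 1) (n - 1)" for x
      by (rule mat_delete_carrier[OF A])
    fix i' j' assume "i' < n - 1" "j' < n - 1"
    then show "(\<lambda>x. mat_delete (A x) i j $$ (i', j')) \<in> borel_measurable M"
      using carrier_matD[OF A] by (auto simp: mat_delete_def intro!: m)
  qed
  then show ?thesis unfolding cofactor_def by measurable
qed

text \<open>The minor belonging to \<open>(i, j)\<close> is formed after deleting row
  \<open>i\<close>, so it cannot see changes in that row.\<close>

lemma cofactor_cong_off_row:
  assumes "A \<in> carrier_mat n n" "A' \<in> carrier_mat n n" "i < n"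
    and "\<And>i' j'. i' < n \<Longrightarrow> j' < n \<Longrightarrow> i' \<noteq> i \<Longrightarrow> A $$ (i', j') = A' $$ (i', j')"
  shows "cofactor A i j = cofactor A' i j"
proof -
  have "mat_delete A i j = mat_delete A' i j"
    using assms by (intro eq_matI) (auto simp: mat_delete_def)
  then show ?thesis by (simp add: cofactor_def)
qed

text \<open>Expand both determinants along row \<open>i\<close>: the cofactors agree and only column
  \<open>j\<close> contributes to the difference. Thus the determinant is affine in each entry with
  the cofactor as slope, the fact behind both measure estimates below.\<close>

lemma det_change_entry:
  assumes A: "A \<in> carrier_mat n n" "A' \<in> carrier_mat n n" and ij: "i < n" "j < n"
    and eq: "\<And>i' j'. i' < n \<Longrightarrow> j' < n \<Longrightarrow> (i', j') \<noteq> (i, j) \<Longrightarrow> A' $$ (i', j') = A $$ (i', j')"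
  shows "det A' = det A + (A' $$ (i, j) - A $$ (i, j)) * cofactor A i j"
proof -
  have c: "cofactor A' i k = cofactor A i k" for k
    using A ij eq by (intro cofactor_cong_off_row) auto
  have "det A' - det A = (\<Sum>k<n. (A' $$ (i, k) - A $$ (i, k)) * cofactor A i k)"
    by (simp add: laplace_expansion_row[OF A(1) ij(1)] laplace_expansion_row[OF A(2) ij(1)] c
        left_diff_distrib sum_subtractf)
  also have "\<dots> = (\<Sum>k<n. if k = j then (A' $$ (i, j) - A $$ (i, j)) * cofactor A i j else 0)"
    using ij eq by (intro sum.cong) auto
  also have "\<dots> = (A' $$ (i, j) - A $$ (i, j)) * cofactor A i j"
    using ij by simp
  finally show ?thesis by (simp add: algebra_simps)
qed

text \<open>
  \<open>F x\<close> is the determinant of the matrix with entries \<open>x (v, w)\<close>, for some orderings of \<open>B\<close> and \<open>C\<close>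
  (hence defined up to sign), and \<open>K p x\<close> is the cofactor of the entry \<open>p\<close>.
\<close>

locale det_cofactors =
  fixes B :: "'b set" and C :: "'c set"
    and F :: "('b \<times> 'c \<Rightarrow> real) \<Rightarrow> real" and K :: "'b \<times> 'c \<Rightarrow> ('b \<times> 'c \<Rightarrow> real) \<Rightarrow> real"
  assumes F_meas[measurable]: "F \<in> borel_measurable (Pi\<^sub>M (B \<times> C) (\<lambda>_. lborel))"
    and K_meas: "p \<in> B \<times> C \<Longrightarrow> K p \<in> borel_measurable (Pi\<^sub>M (B \<times> C) (\<lambda>_. lborel))"
    and F_upd: "p \<in> B \<times> C \<Longrightarrow> F (x(p := t)) = F x + (t - x p) * K p x"
    and K_upd: "p \<in> B \<times> C \<Longrightarrow> K p (x(p := t)) = K p x"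
    and sum_row_cofactor: "w \<in> C \<Longrightarrow> w' \<in> C \<Longrightarrow>
      (\<Sum>v\<in>B. x (v, w') * K (v, w) x) = (if w = w' then F x else 0)"
    and sum_column_cofactor: "v \<in> B \<Longrightarrow> v' \<in> B \<Longrightarrow>
      (\<Sum>w\<in>C. K (v, w) x * x (v', w)) = (if v = v' then F x else 0)"
    and nonzero_if_right_inverse: "(\<And>w w'. w \<in> C \<Longrightarrow> w' \<in> C \<Longrightarrow>
      (\<Sum>v\<in>B. x (v, w') * y (v, w)) = (if w = w' then 1 else 0)) \<Longrightarrow> F x \<noteq> 0"

text \<open>Enumerations of both index sets turn \<open>x\<close> into a square matrix, and the row
  and column sums become entries of its products with the adjugate. Later arguments use only the
  locale, so no ordering of the bases is carried along.\<close>

lemma det_cofactors_exist: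
  fixes B :: "'b set" and C :: "'c set"
  assumes finB: "finite B" and finC: "finite C" and card: "card B = card C"
  shows "\<exists>F K. det_cofactors B C F K"
proof -
  define n where "n = card B"
  obtain \<beta> where \<beta>: "bij_betw \<beta> {..<n} B"
    using ex_bij_betw_nat_finite[OF finB] by (auto simp: n_def lessThan_atLeast0)
  obtain \<gamma> where \<gamma>: "bij_betw \<gamma> {..<n} C"
    using ex_bij_betw_nat_finite[OF finC] by (auto simp: n_def card lessThan_atLeast0)
  define \<beta>' \<gamma>' where "\<beta>' = the_inv_into {..<n} \<beta>" and "\<gamma>' = the_inv_into {..<n} \<gamma>"
  have \<beta>i: "\<beta>' v < n" "\<beta> (\<beta>' v) = v" if "v \<in> B" for v
    using \<beta> that f_the_inv_into_f_bij_betw[OF \<beta>] the_inv_into_into[of \<beta> "{..<n}" v "{..<n}"]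
    by (auto simp: \<beta>'_def bij_betw_def)
  have \<gamma>i: "\<gamma>' v < n" "\<gamma> (\<gamma>' v) = v" if "v \<in> C" for v
    using \<gamma> that f_the_inv_into_f_bij_betw[OF \<gamma>] the_inv_into_into[of \<gamma> "{..<n}" v "{..<n}"]
    by (auto simp: \<gamma>'_def bij_betw_def)
  have \<beta>'\<beta>: "\<beta>' (\<beta> i) = i" "\<beta> i \<in> B" if "i < n" for i
    using \<beta> that by (auto simp: \<beta>'_def bij_betw_def the_inv_into_f_f)
  have \<gamma>'\<gamma>: "\<gamma>' (\<gamma> i) = i" "\<gamma> i \<in> C" if "i < n" for i
    using \<gamma> that by (auto simp: \<gamma>'_def bij_betw_def the_inv_into_f_f)
  \<comment> \<open>Columns belong to the source basis and rows to the target basis, as usual for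
    the matrix of a linear map; hence the swapped indices.\<close>
  define A where "A x = mat n n (\<lambda>(i, j). x (\<beta> j, \<gamma> i))" for x :: "'b \<times> 'c \<Rightarrow> real"
  define F where "F x = det (A x)" for x
  define K where "K p x = cofactor (A x) (\<gamma>' (snd p)) (\<beta>' (fst p))" for p x
  have A: "A x \<in> carrier_mat n n" for x by (simp add: A_def)
  have Ai: "A x $$ (i, j) = x (\<beta> j, \<gamma> i)" if "i < n" "j < n" for x i j
    using that by (simp add: A_def)
  have Am: "(\<lambda>x. A x $$ (i, j)) \<in> borel_measurable (Pi\<^sub>M (B \<times> C) (\<lambda>_. lborel))"
    if "i < n" "j < n" for i j
    unfolding Ai[OF that] using that \<beta>'\<beta> \<gamma>'\<gamma>
    by (intro measurable_component_singleton[of _ _ "\<lambda>_. lborel", simplified]) auto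
  have Aupd: "A (x(p := t)) $$ (i, j) = (if p = (\<beta> j, \<gamma> i) then t else A x $$ (i, j))"
    if "i < n" "j < n" for x p t i j using that by (simp add: Ai)
  have ne: "p \<noteq> (\<beta> j, \<gamma> i)"
    if "i < n" "j < n" "p \<in> B \<times> C" "i \<noteq> \<gamma>' (snd p) \<or> j \<noteq> \<beta>' (fst p)" for p i j
    using that \<beta>'\<beta> \<gamma>'\<gamma> by auto
  have entry: "(\<Sum>v\<in>B. x (v, w') * K (v, w) x) = (if w = w' then F x else 0)"
    if w: "w \<in> C" "w' \<in> C" for x w w'
  proof -
    have "(\<Sum>v\<in>B. x (v, w') * K (v, w) x)
        = (\<Sum>j<n. A x $$ (\<gamma>' w', j) * cofactor (A x) (\<gamma>' w) j)"
      using w by (subst sum.reindex_bij_betw[OF \<beta>, symmetric]) (simp add: K_def Ai \<gamma>i \<beta>'\<beta>)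
    \<comment> \<open>The adjugate is the transposed cofactor matrix, so a row of cofactors becomes
      a column of the second factor.\<close>
    also have "\<dots> = (A x * adj_mat (A x)) $$ (\<gamma>' w', \<gamma>' w)"
      using w adj_mat(1)[OF A, of x] \<gamma>i(1) A[of x]
      by (auto simp: scalar_prod_def adj_mat_def lessThan_atLeast0 intro!: sum.cong)
    also have "\<dots> = (if w = w' then F x else 0)"
      using w \<gamma>i(1) \<gamma>i(2)[of w] \<gamma>i(2)[of w'] by (auto simp: adj_mat(2)[OF A] F_def)
    finally show ?thesis .
  qed
  have entry': "(\<Sum>w\<in>C. K (v, w) x * x (v', w)) = (if v = v' then F x else 0)"
    if v: "v \<in> B" "v' \<in> B" for x v v'
  proof -
    have "(\<Sum>w\<in>C. K (v, w) x * x (v', w))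
        = (\<Sum>i<n. cofactor (A x) i (\<beta>' v) * A x $$ (i, \<beta>' v'))"
      using v by (subst sum.reindex_bij_betw[OF \<gamma>, symmetric]) (simp add: K_def Ai \<beta>i \<gamma>'\<gamma>)
    also have "\<dots> = (adj_mat (A x) * A x) $$ (\<beta>' v, \<beta>' v')"
      using v adj_mat(1)[OF A, of x] \<beta>i(1) A[of x]
      by (auto simp: scalar_prod_def adj_mat_def lessThan_atLeast0 intro!: sum.cong)
    also have "\<dots> = (if v = v' then F x else 0)"
      using v \<beta>i(1) \<beta>i(2)[of v] \<beta>i(2)[of v'] by (auto simp: adj_mat(3)[OF A] F_def)
    finally show ?thesis .
  qed
  have nz: "F x \<noteq> 0"
    if y: "\<And>w w'. w \<in> C \<Longrightarrow> w' \<in> C \<Longrightarrow> (\<Sum>v\<in>B. x (v, w') * y (v, w)) = (if w = w' then 1 else 0)"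
    for x and y :: "'b \<times> 'c \<Rightarrow> real"
  proof -
    \<comment> \<open>\<open>y\<close> is indexed like \<open>x\<close>, but rows and columns
      exchange roles, so that the hypothesis says that \<open>Y\<close> is a right inverse of
      \<open>A x\<close>.\<close>
    define Y where "Y = mat n n (\<lambda>(j, i). y (\<beta> j, \<gamma> i))"
    have Y: "Y \<in> carrier_mat n n" by (simp add: Y_def)
    have "A x * Y = 1\<^sub>m n"
    proof (rule eq_matI)
      fix i k assume ik: "i < dim_row (1\<^sub>m n)" "k < dim_col (1\<^sub>m n)"
      have "(A x * Y) $$ (i, k) = (\<Sum>j<n. x (\<beta> j, \<gamma> i) * y (\<beta> j, \<gamma> k))"
        using ik Y A[of x] by (auto simp: scalar_prod_def lessThan_atLeast0 Ai Y_def intro!: sum.cong)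
      also have "\<dots> = (\<Sum>v\<in>B. x (v, \<gamma> i) * y (v, \<gamma> k))"
        by (subst sum.reindex_bij_betw[OF \<beta>, symmetric]) simp
      also have "\<dots> = 1\<^sub>m n $$ (i, k)"
        using ik y[of "\<gamma> k" "\<gamma> i"] \<gamma>'\<gamma>(2) \<gamma>'\<gamma>(1)[of i] \<gamma>'\<gamma>(1)[of k] by auto
      finally show "(A x * Y) $$ (i, k) = 1\<^sub>m n $$ (i, k)" .
    qed (use A[of x] Y in auto)
    then have "det (A x) * det Y = 1" using det_mult[OF A Y, of x] by simp
    then show ?thesis by (auto simp: F_def)
  qed
  have "det_cofactors B C F K"
  proof
    show "F \<in> borel_measurable (Pi\<^sub>M (B \<times> C) (\<lambda>_. lborel))"
      unfolding F_def using A Am by (rule borel_measurable_det)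
    show "K p \<in> borel_measurable (Pi\<^sub>M (B \<times> C) (\<lambda>_. lborel))" for p
      unfolding K_def using A Am by (rule borel_measurable_cofactor)
    show "F (x(p := t)) = F x + (t - x p) * K p x" if p: "p \<in> B \<times> C" for p x t
    proof -
      have *: "\<gamma>' (snd p) < n" "\<beta>' (fst p) < n" "p = (\<beta> (\<beta>' (fst p)), \<gamma> (\<gamma>' (snd p)))"
        using p \<beta>i \<gamma>i by auto
      have "F (x(p := t)) = F x + (A (x(p := t)) $$ (\<gamma>' (snd p), \<beta>' (fst p))
          - A x $$ (\<gamma>' (snd p), \<beta>' (fst p))) * K p x"
        unfolding F_def K_def
        by (rule det_change_entry[OF A A]) (use * Aupd ne[OF _ _ p] in auto)
      then show ?thesis using * by (simp add: Ai)
    qed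
    show "K p (x(p := t)) = K p x" if p: "p \<in> B \<times> C" for p x t
      unfolding K_def using p \<gamma>i(1)
      by (intro cofactor_cong_off_row[OF A A]) (auto simp: Aupd dest: ne[OF _ _ p])
  qed (fact entry entry' nz)+
  then show ?thesis by blast
qed

subsection \<open>Measure estimates in coordinates\<close>

lemma product_sigma_finite_lborel: "product_sigma_finite (\<lambda>_. lborel)"
  by (simp add: product_sigma_finite_def sigma_finite_lborel)

text \<open>Tonelli with one distinguished coordinate: a set is measured by the lengths of its
  slices in direction \<open>i\<close>.\<close>

lemma insert_iterated_emeasure:
  assumes I: "finite I" "i \<notin> I" and S: "S \<in> sets (Pi\<^sub>M (insert i I) (\<lambda>_. lborel :: real measure))"
  shows "emeasure (Pi\<^sub>M (insert i I) (\<lambda>_. lborel)) S =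
    (\<integral>\<^sup>+ x. emeasure lborel {t. x(i := t) \<in> S} \<partial>Pi\<^sub>M I (\<lambda>_. lborel))"
proof -
  interpret product_sigma_finite "\<lambda>_. lborel :: real measure" by (rule product_sigma_finite_lborel)
  have "emeasure (Pi\<^sub>M (insert i I) (\<lambda>_. lborel)) S =
      (\<integral>\<^sup>+ x. (\<integral>\<^sup>+ t. indicator S (x(i := t)) \<partial>lborel) \<partial>Pi\<^sub>M I (\<lambda>_. lborel))"
    using S by (simp flip: nn_integral_indicator add: product_nn_integral_insert[OF I])
  also have "\<dots> = (\<integral>\<^sup>+ x. emeasure lborel {t. x(i := t) \<in> S} \<partial>Pi\<^sub>M I (\<lambda>_. lborel))"
  proof (rule nn_integral_cong)
    fix x :: "'a \<Rightarrow> real" assume "x \<in> space (Pi\<^sub>M I (\<lambda>_. lborel))"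
    then have "(\<lambda>t. x(i := t)) \<in> lborel \<rightarrow>\<^sub>M Pi\<^sub>M (insert i I) (\<lambda>_. lborel)"
      by (intro measurable_fun_upd[of _ I]) auto
    from measurable_sets[OF this S] have "{t. x(i := t) \<in> S} \<in> sets lborel"
      by (simp add: vimage_def)
    moreover have "(\<lambda>t. indicator S (x(i := t)) :: ennreal) = indicator {t. x(i := t) \<in> S}"
      by (auto simp: fun_eq_iff split: split_indicator)
    ultimately show "(\<integral>\<^sup>+ t. indicator S (x(i := t)) \<partial>lborel) = emeasure lborel {t. x(i := t) \<in> S}"
      by simp
  qed
  finally show ?thesis .
qed

text \<open>Induction on the coordinates: once almost every line in the new direction is known to
  contain a point with \<open>F\<close> nonzero, almost every slice of the zero set is finite, hence
  null. Applied to the determinant, it shows that the non-invertible maps form a null set.\<close>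

lemma zero_set_null_of_coordinatewise_finite:
  fixes F :: "('i \<Rightarrow> real) \<Rightarrow> real"
  assumes "finite I"
    and "F \<in> borel_measurable (Pi\<^sub>M I (\<lambda>_. lborel))"
    and "\<And>i x. i \<in> I \<Longrightarrow> (\<forall>t. F (x(i := t)) = 0) \<or> finite {t. F (x(i := t)) = 0}"
    and "x0 \<in> I \<rightarrow>\<^sub>E UNIV" "F x0 \<noteq> 0"
  shows "AE x in Pi\<^sub>M I (\<lambda>_. lborel). F x \<noteq> 0"
  using assms
proof (induction I arbitrary: F x0 rule: finite_induct)
  case empty
  then show ?case by (intro AE_I2) (auto simp: space_PiM)
next
  case (insert i I)
  note [measurable] = insert.prems(1)
  let ?Z = "{x \<in> space (Pi\<^sub>M (insert i I) (\<lambda>_. lborel)). F x = 0}"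
  \<comment> \<open>The induction hypothesis is applied to \<open>F\<close> with coordinate
    \<open>i\<close> frozen at its value in the witness \<open>x0\<close>.\<close>
  have "AE x in Pi\<^sub>M I (\<lambda>_. lborel). F (x(i := x0 i)) \<noteq> 0"
  proof (rule insert.IH)
    show "(\<lambda>x. F (x(i := x0 i))) \<in> borel_measurable (Pi\<^sub>M I (\<lambda>_. lborel))"
      by (rule measurable_compose[OF _ insert.prems(1)])
        (intro measurable_fun_upd[of _ I], auto)
    show "(\<forall>t. F ((x(j := t))(i := x0 i)) = 0) \<or> finite {t. F ((x(j := t))(i := x0 i)) = 0}"
      if "j \<in> I" for j x
    proof -
      have "(x(j := t))(i := x0 i) = (x(i := x0 i))(j := t)" for t
        using that insert.hyps by (auto simp: fun_upd_twist)
      then show ?thesis using insert.prems(2)[of j "x(i := x0 i)"] that by (simp del: fun_upd_apply)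
    qed
    show "restrict x0 I \<in> I \<rightarrow>\<^sub>E UNIV" by simp
    have "(restrict x0 I)(i := x0 i) = x0"
      using insert.prems(3) by (auto simp: fun_eq_iff PiE_def extensional_def)
    then show "F ((restrict x0 I)(i := x0 i)) \<noteq> 0" using insert.prems(4) by simp
  qed
  then have "AE x in Pi\<^sub>M I (\<lambda>_. lborel). emeasure lborel {t. x(i := t) \<in> ?Z} = 0"
  proof eventually_elim
    case (elim x)
    \<comment> \<open>The value at \<open>t = x0 i\<close> is nonzero, which excludes an identically
      vanishing slice.\<close>
    then have "finite {t. F (x(i := t)) = 0}" using insert.prems(2)[of i x] by (metis insertI1)
    then have "finite {t. x(i := t) \<in> ?Z}" by (rule rev_finite_subset) auto
    then show ?case by (intro emeasure_lborel_countable countable_finite)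
  qed
  then have "(\<integral>\<^sup>+ x. emeasure lborel {t. x(i := t) \<in> ?Z} \<partial>Pi\<^sub>M I (\<lambda>_. lborel)) = 0"
    by (subst nn_integral_cong_AE[of _ "\<lambda>_. 0"]) auto
  moreover have "?Z \<in> sets (Pi\<^sub>M (insert i I) (\<lambda>_. lborel))" by measurable
  ultimately have "emeasure (Pi\<^sub>M (insert i I) (\<lambda>_. lborel)) ?Z = 0"
    by (simp only: insert_iterated_emeasure[OF insert.hyps])
  then show ?case by (subst AE_iff_measurable[OF _ refl]) auto
qed

text \<open>The open ball of the maximum norm. Its product form suits slicing, and it is comparable
  to the Euclidean ball up to a constant factor in the radius.\<close>

definition coord_box :: "'i set \<Rightarrow> ('i \<Rightarrow> real) \<Rightarrow> real \<Rightarrow> ('i \<Rightarrow> real) set"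
  where "coord_box I x0 r = (\<Pi>\<^sub>E i\<in>I. {x0 i - r<..<x0 i + r})"

lemma sets_coord_box: "finite I \<Longrightarrow> coord_box I x0 r \<in> sets (Pi\<^sub>M I (\<lambda>_. lborel))"
  unfolding coord_box_def by (intro sets_PiM_I_finite) auto

lemma emeasure_coord_box:
  assumes "finite I" "r > 0"
  shows "emeasure (Pi\<^sub>M I (\<lambda>_. lborel)) (coord_box I x0 r) = ennreal ((2 * r) ^ card I)"
proof -
  interpret product_sigma_finite "\<lambda>_. lborel :: real measure" by (rule product_sigma_finite_lborel)
  show ?thesis
    unfolding coord_box_def using assms
    by (subst emeasure_PiM) (auto simp: ennreal_power)
qed

text \<open>Along direction \<open>p\<close>, \<open>K\<close> is constant and \<open>F\<close> is
  affine with slope \<open>K\<close>, so the inequality confines \<open>t\<close> to distance less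
  than \<open>1 / M\<close> from the zero of \<open>F\<close>. The slice length \<open>2 / M\<close>
  does not depend on \<open>F\<close> and \<open>K\<close>; integrating over the box in the
  remaining coordinates gives the bound.\<close>

lemma emeasure_affine_quotient_large:
  fixes F K :: "('i \<Rightarrow> real) \<Rightarrow> real"
  assumes I: "finite I" "p \<in> I" and M: "M > 0" and r: "r > 0"
    and [measurable]: "F \<in> borel_measurable (Pi\<^sub>M I (\<lambda>_. lborel))"
      "K \<in> borel_measurable (Pi\<^sub>M I (\<lambda>_. lborel))"
    and F: "\<And>x t. F (x(p := t)) = F x + (t - x p) * K x"
    and K: "\<And>x t. K (x(p := t)) = K x"
  shows "emeasure (Pi\<^sub>M I (\<lambda>_. lborel)) {x \<in> coord_box I x0 r. M * \<bar>F x\<bar> < \<bar>K x\<bar>}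
    \<le> ennreal ((2 * r) ^ (card I - 1) * (2 / M))"
proof -
  define J where "J = I - {p}"
  have J: "finite J" "p \<notin> J" and IJ: "I = insert p J" using I by (auto simp: J_def)
  let ?S = "{x \<in> coord_box I x0 r. M * \<bar>F x\<bar> < \<bar>K x\<bar>}"
  have "?S = coord_box I x0 r \<inter> {x \<in> space (Pi\<^sub>M I (\<lambda>_. lborel)). M * \<bar>F x\<bar> < \<bar>K x\<bar>}"
    using sets.sets_into_space[OF sets_coord_box[OF I(1)]] by auto
  also have "\<dots> \<in> sets (Pi\<^sub>M I (\<lambda>_. lborel))"
    by (intro sets.Int sets_coord_box I) measurable
  finally have S: "?S \<in> sets (Pi\<^sub>M (insert p J) (\<lambda>_. lborel))" by (simp add: IJ)
  have "emeasure (Pi\<^sub>M I (\<lambda>_. lborel)) ?S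
      = (\<integral>\<^sup>+ x. emeasure lborel {t. x(p := t) \<in> ?S} \<partial>Pi\<^sub>M J (\<lambda>_. lborel))"
    using insert_iterated_emeasure[OF J S] by (simp flip: IJ)
  also have "\<dots> \<le> (\<integral>\<^sup>+ x. ennreal (2 / M) * indicator (coord_box J x0 r) x \<partial>Pi\<^sub>M J (\<lambda>_. lborel))"
  proof (rule nn_integral_mono)
    fix x :: "'i \<Rightarrow> real" assume "x \<in> space (Pi\<^sub>M J (\<lambda>_. lborel))"
    then have x: "x \<in> J \<rightarrow>\<^sub>E UNIV" by (simp add: space_PiM)
    \<comment> \<open>The zero of \<open>F (x(p := t))\<close> in \<open>t\<close>, whatever value
      \<open>x\<close> has at \<open>p\<close>. If \<open>K x = 0\<close>, the slice is empty and
      \<open>c\<close> is irrelevant.\<close>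
    define c where "c = x p - F x / K x"
    have sub: "x \<in> coord_box J x0 r \<and> t \<in> {c - 1 / M .. c + 1 / M}" if t: "x(p := t) \<in> ?S" for t
    proof
      have "x i \<in> {x0 i - r<..<x0 i + r}" if "i \<in> J" for i
        using t that J by (auto simp: coord_box_def PiE_iff IJ split: if_splits)
      then show "x \<in> coord_box J x0 r" using x by (auto simp: coord_box_def PiE_iff)
      have lt: "M * \<bar>F x + (t - x p) * K x\<bar> < \<bar>K x\<bar>" using t by (simp add: F K)
      moreover have "0 \<le> M * \<bar>F x + (t - x p) * K x\<bar>" using M by simp
      ultimately have K0: "K x \<noteq> 0" by auto
      have "F x + (t - x p) * K x = (t - c) * K x" using K0 by (simp add: c_def field_simps)
      then have "(M * \<bar>t - c\<bar>) * \<bar>K x\<bar> < 1 * \<bar>K x\<bar>" using lt by (simp add: abs_mult)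
      then have "M * \<bar>t - c\<bar> < 1" using K0 by (simp only: mult_less_cancel_right)
      then have "\<bar>t - c\<bar> < 1 / M" using M by (simp add: field_simps)
      then show "t \<in> {c - 1 / M .. c + 1 / M}" by auto
    qed
    show "emeasure lborel {t. x(p := t) \<in> ?S} \<le> ennreal (2 / M) * indicator (coord_box J x0 r) x"
    proof (cases "x \<in> coord_box J x0 r")
      case True
      have "emeasure lborel {t. x(p := t) \<in> ?S} \<le> emeasure lborel {c - 1 / M .. c + 1 / M}"
        using sub by (intro emeasure_mono) auto
      then show ?thesis using True M by simp
    next
      case False
      then have empty: "{t. x(p := t) \<in> ?S} = {}" using sub by blast
      show ?thesis unfolding empty by simp
    qed
  qed
  also have "\<dots> = ennreal (2 / M) * ennreal ((2 * r) ^ card J)"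
    using J r by (subst nn_integral_cmult_indicator) (simp_all add: sets_coord_box emeasure_coord_box)
  also have "\<dots> = ennreal ((2 * r) ^ (card I - 1) * (2 / M))"
    using J M r by (simp add: IJ mult.commute flip: ennreal_mult)
  finally show ?thesis .
qed

lemma coord_ball_subset_box: "finite I \<Longrightarrow> coord_ball I x0 r \<subseteq> coord_box I x0 r"
proof
  fix x assume fin: "finite I" and x: "x \<in> coord_ball I x0 r"
  have "\<bar>x i - x0 i\<bar> < r" if "i \<in> I" for i
    using x member_le_L2_set[OF fin that, of "\<lambda>i. \<bar>x i - x0 i\<bar>"]
    by (auto simp: coord_ball_def L2_set_def)
  then show "x \<in> coord_box I x0 r"
    using x by (force simp: coord_ball_def coord_box_def PiE_iff abs_less_iff)
qed

text \<open>The Euclidean norm is at most the sum of the absolute coordinates. The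
  \<open>+ 1\<close> makes the bound strict and the denominator nonzero for empty
  \<open>I\<close>.\<close>

lemma coord_box_subset_ball:
  assumes "finite I" "r > 0"
  shows "coord_box I x0 (r / (real (card I) + 1)) \<subseteq> coord_ball I x0 r"
proof
  fix x assume x: "x \<in> coord_box I x0 (r / (real (card I) + 1))"
  have le: "\<bar>x i - x0 i\<bar> \<le> r / (real (card I) + 1)" if "i \<in> I" for i
    using x that unfolding coord_box_def PiE_iff by (force simp: abs_le_iff)
  have "L2_set (\<lambda>i. x i - x0 i) I \<le> (\<Sum>i\<in>I. \<bar>x i - x0 i\<bar>)" by (rule L2_set_le_sum_abs)
  also have "\<dots> \<le> real (card I) * (r / (real (card I) + 1))" using sum_bounded_above[OF le] by simp
  also have "\<dots> < r" using assms by (simp add: field_simps)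
  finally show "x \<in> coord_ball I x0 r" using x by (auto simp: coord_ball_def coord_box_def)
qed

lemma sets_coord_ball:
  assumes "finite I" shows "coord_ball I x0 r \<in> sets (Pi\<^sub>M I (\<lambda>_. lborel))"
proof -
  have "(\<lambda>x. x i) \<in> borel_measurable (Pi\<^sub>M I (\<lambda>_. lborel :: real measure))" if "i \<in> I" for i :: 'a
    using measurable_component_singleton[OF that, of "\<lambda>_. lborel :: real measure"] by simp
  then have "(\<lambda>x. L2_set (\<lambda>i. x i - x0 i) I) \<in> borel_measurable (Pi\<^sub>M I (\<lambda>_. lborel))"
    unfolding L2_set_def by measurable
  then have "{x \<in> space (Pi\<^sub>M I (\<lambda>_. lborel)). L2_set (\<lambda>i. x i - x0 i) I < r} \<in> sets (Pi\<^sub>M I (\<lambda>_. lborel))"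
    by measurable
  then show ?thesis by (simp add: coord_ball_def space_PiM)
qed

text \<open>The ball has measure at least a constant times \<open>r ^ card I\<close>, by its
  inscribed box. The extra power of \<open>r\<close> in the bound thus makes the relative measure of
  the complement \<open>O(r)\<close>.\<close>

lemma density_oneI:
  assumes I: "finite I" and A: "A \<in> sets (Pi\<^sub>M I (\<lambda>_. lborel))" and r0: "r0 > 0"
    and bound: "\<And>r. 0 < r \<Longrightarrow> r < r0 \<Longrightarrow>
      emeasure (Pi\<^sub>M I (\<lambda>_. lborel)) (coord_ball I x0 r - A) \<le> ennreal (c * r ^ (card I + 1))"
  shows "density_one I A x0"
  unfolding density_one_def
proof
  let ?P = "Pi\<^sub>M I (\<lambda>_. lborel) :: ('a \<Rightarrow> real) measure" and ?N = "card I"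
  let ?b = "coord_ball I x0"
  show "A \<in> sets (coord_lebesgue I)" using A by (simp add: coord_lebesgue_def)
  \<comment> \<open>\<open>k * r ^ ?N\<close> is the measure of the inscribed box of half-side
    \<open>r / (real ?N + 1)\<close>.\<close>
  define k where "k = (2 / (real ?N + 1)) ^ ?N"
  have k: "k > 0" by (simp add: k_def)
  \<comment> \<open>Monotonicity steps need a nonnegative constant, while \<open>c\<close> is
    arbitrary.\<close>
  define c' where "c' = max c 0"
  note b = sets_coord_ball[OF I, of x0]
  have *: "1 - c' / k * r \<le> measure ?P (A \<inter> ?b r) / measure ?P (?b r) \<and>
      measure ?P (A \<inter> ?b r) / measure ?P (?b r) \<le> 1" if r: "0 < r" "r < r0" for r
  proof -
    have "emeasure ?P (?b r) \<le> emeasure ?P (coord_box I x0 r)"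
      by (intro emeasure_mono coord_ball_subset_box sets_coord_box I)
    also have "\<dots> < \<infinity>" using I r by (simp add: emeasure_coord_box)
    finally have fin: "?b r \<in> fmeasurable ?P" using b by (intro fmeasurableI) auto
    have "k * r ^ ?N = measure ?P (coord_box I x0 (r / (real ?N + 1)))"
      using I r by (simp add: measure_def emeasure_coord_box k_def field_simps)
    also have "\<dots> \<le> measure ?P (?b r)"
      by (intro measure_mono_fmeasurable coord_box_subset_ball sets_coord_box I r fin)
    finally have lower: "k * r ^ ?N \<le> measure ?P (?b r)" .
    moreover have "0 < k * r ^ ?N" using k r by simp
    ultimately have pos: "0 < measure ?P (?b r)" by linarith
    have "emeasure ?P (?b r - A) \<le> ennreal (c' * r ^ (?N + 1))"
      using r by (intro order_trans[OF bound[OF r]] ennreal_leI mult_right_mono) (auto simp: c'_def)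
    then have "measure ?P (?b r - A) \<le> c' * r ^ (?N + 1)"
      using r unfolding measure_def c'_def by (intro enn2real_leI) auto
    also have "\<dots> = c' / k * r * (k * r ^ ?N)" using k by simp
    also have "\<dots> \<le> c' / k * r * measure ?P (?b r)"
      using lower k r by (intro mult_left_mono) (auto simp: c'_def)
    finally have upper: "measure ?P (?b r - A) \<le> c' / k * r * measure ?P (?b r)" .
    have "measure ?P (?b r) = measure ?P (?b r - A) + measure ?P (A \<inter> ?b r)"
      using fin A b fmeasurable_Diff[OF fin A] fmeasurable_Int_fmeasurable[OF fin A]
      by (subst measure_Union[symmetric])
        (auto dest: fmeasurableD2 simp: Int_commute intro!: arg_cong[where f = "measure ?P"])
    then show ?thesis using pos upper by (simp add: field_simps)
  qed
  have "((\<lambda>r. measure ?P (A \<inter> ?b r) / measure ?P (?b r)) \<longlongrightarrow> 1) (at_right 0)"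
  proof (rule tendsto_sandwich)
    have ev: "eventually (\<lambda>r. 0 < r \<and> r < r0) (at_right 0)"
      using r0 by (auto simp: eventually_at_right_field)
    show "eventually (\<lambda>r. 1 - c' / k * r \<le> measure ?P (A \<inter> ?b r) / measure ?P (?b r)) (at_right 0)"
      using ev by eventually_elim (use * in auto)
    show "eventually (\<lambda>r. measure ?P (A \<inter> ?b r) / measure ?P (?b r) \<le> 1) (at_right 0)"
      using ev by eventually_elim (use * in auto)
    show "((\<lambda>r. 1 - c' / k * r) \<longlongrightarrow> 1) (at_right 0)"
      by (rule tendsto_eq_intros refl | simp)+
  qed simp
  \<comment> \<open>All sets involved lie in the product sigma-algebra, where the completion has the
    same measure.\<close>
  then show "((\<lambda>r. measure (coord_lebesgue I) (A \<inter> ?b r) / measure (coord_lebesgue I) (?b r)) \<longlongrightarrow> 1) (at_right 0)"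
    using A b by (simp add: coord_lebesgue_def sets.Int)
qed

subsection \<open>Linear maps in coordinates\<close>

lemma is_basis_finite_card:
  fixes B S :: "'v::real_vector set"
  assumes B: "is_basis B" and S: "finite S" "span S = UNIV"
  shows "finite B" "card B = dim (UNIV :: 'v set)"
proof -
  show "finite B"
    using B S real_vector.independent_span_bound[of S B] by (auto simp: is_basis_def)
  show "card B = dim (UNIV :: 'v set)"
    using B real_vector.dim_eq_card[of B UNIV] by (auto simp: is_basis_def)
qed

lemma linear_eq_sum_representation:
  fixes g :: "'v::real_vector \<Rightarrow> 'w::real_vector"
  assumes B: "is_basis B" "finite B" and g: "linear g"
  shows "g u = (\<Sum>v\<in>B. representation B u v *\<^sub>R g v)"
proof -
  have "(\<Sum>v\<in>B. representation B u v *\<^sub>R v) = u"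
    using B by (intro real_vector.sum_representation_eq) (auto simp: is_basis_def)
  then have "g u = g (\<Sum>v\<in>B. representation B u v *\<^sub>R v)" by simp
  then show ?thesis by (simp add: linear_sum[OF g] linear_scale[OF g])
qed

lemma linear_representation:
  assumes "is_basis C" shows "linear (\<lambda>y. representation C y w)"
  using assms
  by (intro linearI) (auto simp: is_basis_def real_vector.representation_add real_vector.representation_scale)

lemma representation_basis_elem:
  assumes "is_basis C" "w \<in> C"
  shows "representation C w w' = (if w = w' then 1 else 0)"
  using assms by (auto simp: is_basis_def real_vector.representation_basis)

lemma linear_representation_image:
  fixes g :: "'v::real_vector \<Rightarrow> 'w::real_vector"
  assumes B: "is_basis B" "finite B" and C: "is_basis C" and g: "linear g"
  shows "representation C (g u) w = (\<Sum>v\<in>B. representation B u v * representation C (g v) w)"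
  using linear_eq_sum_representation[OF B linear_compose[OF g linear_representation[OF C, of w]], of u]
  by (simp add: o_def)

lemma linear_id_if_representation_basis:
  fixes g :: "'v::real_vector \<Rightarrow> 'v"
  assumes B: "is_basis B" "finite B" and g: "linear g"
    and eq: "\<And>v v'. v \<in> B \<Longrightarrow> v' \<in> B \<Longrightarrow> representation B (g v) v' = (if v = v' then 1 else 0)"
  shows "g = id"
proof -
  have "g v = v" if v: "v \<in> B" for v
  proof -
    have "g v = (\<Sum>v'\<in>B. representation B (g v) v' *\<^sub>R v')"
      using linear_eq_sum_representation[OF B linear_id, of "g v"] by simp
    also have "\<dots> = (\<Sum>v'\<in>B. if v = v' then v' else 0)"
      using eq[OF v] by (intro sum.cong) auto
    also have "\<dots> = v" using v B by simp
    finally show ?thesis .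
  qed
  then show ?thesis
    using linear_eq_on_span[OF g linear_id, of B] B by (auto simp: is_basis_def)
qed

text \<open>The case of fixed bases, with the functional factored as \<open>m \<circ> f\<close> and
  \<open>b\<close> written as \<open>f a\<close>. In this form the deviation from the limit is
  \<open>m\<close> applied to values of \<open>g - f\<close>.\<close>

lemma hom_ap_lim_at_bases:
  fixes f :: "'v::real_vector \<Rightarrow> 'w::real_vector" and m :: "'w \<Rightarrow> real"
  assumes f: "linear f" and m: "linear m"
    and B: "is_basis B" "finite B" and C: "is_basis C" "finite C" and card: "card B = card C"
  shows "ap_lim (B \<times> C) (hom_coords B C ` {g. linear g \<and> bij g})
    (\<lambda>x. m (f (inv (the_inv_into {g. linear g} (hom_coords B C) x) (f a))))
    (hom_coords B C f) (m (f a))"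
proof -
  let ?I = "B \<times> C" and ?P = "Pi\<^sub>M (B \<times> C) (\<lambda>_. lborel) :: ('v \<times> 'w \<Rightarrow> real) measure"
  let ?n = "card B"
  have finI: "finite ?I" using B C by simp
  obtain F K where "det_cofactors B C F K"
    using det_cofactors_exist[OF B(2) C(2) card] by blast
  then interpret det_cofactors B C F K .

  \<comment> \<open>Coordinates, Cramer's rule and invertibility\<close>
  define G where "G x = the_inv_into {g. linear g} (hom_coords B C) x" for x
  note bij = hom_coords_bij_betw[OF B(1) C(1) C(2)]
  have G_lin: "linear (G x)" and G_coords: "hom_coords B C (G x) = x"
    if "x \<in> ?I \<rightarrow>\<^sub>E UNIV" for x
    using that f_the_inv_into_f_bij_betw[OF bij, of x] bij
      the_inv_into_into[of "hom_coords B C" "{g. linear g}" x "{g. linear g}"]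
    by (auto simp: G_def bij_betw_def)
  have G_hom: "G (hom_coords B C g) = g" if "linear g" for g
    using that bij by (auto simp: G_def bij_betw_def the_inv_into_f_f)
  have rep_coords: "representation C (g v) w = hom_coords B C g (v, w)"
    if "v \<in> B" "w \<in> C" for g :: "'v \<Rightarrow> 'w" and v w using that by (simp add: hom_coords_def)
  have coords_PiE: "hom_coords B C g \<in> ?I \<rightarrow>\<^sub>E UNIV" for g :: "'v \<Rightarrow> 'w"
    by (auto simp: hom_coords_def)

  \<comment> \<open>The candidate inverse \<open>k\<close> is defined on \<open>C\<close> by
    cofactors over \<open>F x\<close>; the row and column identities verify the two compositions on
    basis vectors.\<close>
  have cramer: "bij (G x) \<and> linear (inv (G x)) \<and>
      (\<forall>v\<in>B. \<forall>w\<in>C. representation B (inv (G x) w) v = K (v, w) x / F x)"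
    if x: "x \<in> ?I \<rightarrow>\<^sub>E UNIV" and nz: "F x \<noteq> 0" for x
  proof -
    have rep_G: "representation C (G x v) w = x (v, w)" if "v \<in> B" "w \<in> C" for v w
      using rep_coords[OF that, of "G x"] G_coords[OF x] by simp
    obtain k where k: "linear k" "\<forall>w\<in>C. k w = (\<Sum>v\<in>B. (K (v, w) x / F x) *\<^sub>R v)"
      using linear_independent_extend[of C "\<lambda>w. \<Sum>v\<in>B. (K (v, w) x / F x) *\<^sub>R v"] C
      by (auto simp: is_basis_def)
    have rep_k: "representation B (k w) v = K (v, w) x / F x" if "w \<in> C" "v \<in> B" for w v
    proof -
      note lin = linear_representation[OF B(1), of v]
      have "representation B (k w) v = (\<Sum>v'\<in>B. K (v', w) x / F x * representation B v' v)"
        using k that by (simp add: linear_sum[OF lin] linear_scale[OF lin])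
      also have "\<dots> = (\<Sum>v'\<in>B. if v' = v then K (v, w) x / F x else 0)"
        by (intro sum.cong) (auto simp: representation_basis_elem[OF B(1)])
      also have "\<dots> = K (v, w) x / F x" using that B by simp
      finally show ?thesis .
    qed
    have "G x \<circ> k = id"
    proof (rule linear_id_if_representation_basis[OF C])
      show "linear (G x \<circ> k)" by (intro linear_compose k G_lin x)
      fix w w' assume w: "w \<in> C" "w' \<in> C"
      have "representation C ((G x \<circ> k) w) w' = (\<Sum>v\<in>B. x (v, w') * K (v, w) x) / F x"
        unfolding o_apply
        by (subst linear_representation_image[OF B C(1) G_lin[OF x]])
          (simp add: rep_k rep_G w sum_divide_distrib mult.commute)
      then show "representation C ((G x \<circ> k) w) w' = (if w = w' then 1 else 0)"
        using nz by (simp add: sum_row_cofactor w)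
    qed
    moreover have "k \<circ> G x = id"
    proof (rule linear_id_if_representation_basis[OF B])
      show "linear (k \<circ> G x)" by (intro linear_compose k G_lin x)
      fix v v' assume v: "v \<in> B" "v' \<in> B"
      have "representation B ((k \<circ> G x) v) v' = (\<Sum>w\<in>C. K (v', w) x * x (v, w)) / F x"
        unfolding o_apply
        by (subst linear_representation_image[OF C B(1) k(1)])
          (simp add: rep_k rep_G v sum_divide_distrib mult.commute)
      then show "representation B ((k \<circ> G x) v) v' = (if v = v' then 1 else 0)"
        using nz by (auto simp: sum_column_cofactor v)
    qed
    ultimately have "bij (G x)" "inv (G x) = k" by (auto intro: o_bij inv_unique_comp)
    then show ?thesis using rep_k k(1) by simp
  qed

  have F_bij: "F (hom_coords B C g) \<noteq> 0" if g: "linear g" "bij g" for g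
  proof (rule nonzero_if_right_inverse)
    fix w w' assume w: "w \<in> C" "w' \<in> C"
    have "(\<Sum>v\<in>B. hom_coords B C g (v, w') * (\<lambda>(v, w). representation B (inv g w) v) (v, w))
        = representation C (g (inv g w)) w'"
      by (subst linear_representation_image[OF B C(1) g(1)])
        (simp add: rep_coords[symmetric] w mult.commute)
    then show "(\<Sum>v\<in>B. hom_coords B C g (v, w') * (\<lambda>(v, w). representation B (inv g w) v) (v, w))
        = (if w = w' then 1 else 0)"
      using w g by (simp add: bij_is_surj surj_f_inv_f representation_basis_elem[OF C(1)])
  qed

  \<comment> \<open>The domain and measurability\<close>
  define D where "D = hom_coords B C ` {g. linear g \<and> bij g}"
  have D_eq: "D = {x \<in> space ?P. F x \<noteq> 0}"
  proof (intro equalityI subsetI)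
    fix x assume "x \<in> D"
    then show "x \<in> {x \<in> space ?P. F x \<noteq> 0}"
      using F_bij coords_PiE by (auto simp: D_def space_PiM)
  next
    fix x assume "x \<in> {x \<in> space ?P. F x \<noteq> 0}"
    then show "x \<in> D"
      using cramer[of x] G_lin[of x] G_coords[of x]
      by (auto simp: D_def space_PiM intro!: image_eqI[of x _ "G x"])
  qed
  then have D_sets: "D \<in> sets ?P" by simp

  define h where "h x = m (f (inv (G x) (f a)))" for x
  \<comment> \<open>The rational expression that Cramer's rule gives for \<open>h\<close> on
    \<open>D\<close>; unlike \<open>h\<close>, it is visibly measurable.\<close>
  define H where "H x = (\<Sum>w\<in>C. representation C (f a) w *
      (\<Sum>v\<in>B. K (v, w) x / F x * m (f v)))" for x
  have H_meas[measurable]: "H \<in> borel_measurable ?P"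
    unfolding H_def by (intro borel_measurable_sum borel_measurable_times borel_measurable_divide
        borel_measurable_const F_meas K_meas) auto
  have mf: "linear (\<lambda>u. m (f u))" using linear_compose[OF f m] by (simp add: o_def)
  have hH: "h x = H x" if "x \<in> D" for x
  proof -
    have x: "x \<in> ?I \<rightarrow>\<^sub>E UNIV" "F x \<noteq> 0" using that by (auto simp: D_eq space_PiM)
    note cr = cramer[OF x]
    have "linear (\<lambda>y. m (f (inv (G x) y)))"
      using linear_compose[OF _ mf, of "inv (G x)"] cr by (simp add: o_def)
    then have "h x = (\<Sum>w\<in>C. representation C (f a) w *\<^sub>R m (f (inv (G x) w)))"
      unfolding h_def by (rule linear_eq_sum_representation[OF C])
    also have "\<dots> = H x"
      unfolding H_def using cr
      by (intro sum.cong refl) (subst linear_eq_sum_representation[OF B mf], simp)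
    finally show ?thesis .
  qed

  \<comment> \<open>Invertible maps have full measure\<close>
  have F_ae: "AE x in ?P. F x \<noteq> 0"
  proof -
    obtain \<sigma> where \<sigma>: "bij_betw \<sigma> B C"
      using finite_same_card_bij[OF B(2) C(2) card] by auto
    \<comment> \<open>A permutation matrix: its transpose is its inverse, so \<open>e\<close> serves
      as its own \<open>y\<close> in the criterion for \<open>F e\<close> to be nonzero.\<close>
    define e where "e = (\<lambda>p\<in>?I. if \<sigma> (fst p) = snd p then 1 else 0 :: real)"
    have "F e \<noteq> 0"
    proof (rule nonzero_if_right_inverse)
      fix w w' assume w: "w \<in> C" "w' \<in> C"
      have "(\<Sum>v\<in>B. e (v, w') * e (v, w)) = (\<Sum>v\<in>B. if \<sigma> v = w then if w = w' then 1 else 0 else 0)"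
        using w by (intro sum.cong) (auto simp: e_def)
      also have "\<dots> = (\<Sum>u\<in>C. if u = w then if w = w' then 1 else 0 else 0)"
        by (rule sum.reindex_bij_betw[OF \<sigma>])
      also have "\<dots> = (if w = w' then 1 else 0)" using w C by simp
      finally show "(\<Sum>v\<in>B. e (v, w') * e (v, w)) = (if w = w' then 1 else 0)" .
    qed
    moreover have "e \<in> ?I \<rightarrow>\<^sub>E UNIV" by (simp add: e_def)
    moreover have "(\<forall>t. F (x(p := t)) = 0) \<or> finite {t. F (x(p := t)) = 0}"
      if p: "p \<in> ?I" for p x
    proof (cases "K p x = 0")
      case True
      then show ?thesis by (auto simp: F_upd[OF p])
    next
      case False
      then have "{t. F (x(p := t)) = 0} \<subseteq> {x p - F x / K p x}"
        by (auto simp: F_upd[OF p] field_simps)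
      then show ?thesis using finite_subset by blast
    qed
    ultimately show ?thesis
      using zero_set_null_of_coordinatewise_finite[OF finI F_meas] by blast
  qed

  \<comment> \<open>The pointwise perturbation estimate\<close>
  define x0 where "x0 = hom_coords B C f"
  define \<alpha> where "\<alpha> = (\<Sum>v\<in>B. \<bar>representation B a v\<bar>)"
  define \<mu> where "\<mu> = (\<Sum>w\<in>C. \<bar>m w\<bar>)"
  have \<alpha>0: "\<alpha> \<ge> 0" and \<mu>0: "\<mu> \<ge> 0" by (auto simp: \<alpha>_def \<mu>_def intro: sum_nonneg)
  \<comment> \<open>The two summands bound \<open>m (X a)\<close> and \<open>m (X z)\<close> with
    \<open>X = G x - f\<close> and \<open>z = inv (G x) (X a)\<close>. \<open>M\<close> bounds the
    entries of the inverse; one factor \<open>?n\<close> comes from the sum over \<open>C\<close> in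
    each coordinate of \<open>z\<close>, the other from adding these coordinates over
    \<open>B\<close>.\<close>
  have estimate: "\<bar>h x - m (f a)\<bar> \<le> r * \<mu> * \<alpha> + r * \<mu> * (real ?n * (real ?n * (\<alpha> * r * M)))"
    if x: "x \<in> coord_box ?I x0 r" "F x \<noteq> 0" and M: "\<And>p. p \<in> ?I \<Longrightarrow> \<bar>K p x\<bar> \<le> M * \<bar>F x\<bar>"
      and r: "r > 0" for x r M
  proof -
    have xP: "x \<in> ?I \<rightarrow>\<^sub>E UNIV" using x by (auto simp: coord_box_def)
    note cr = cramer[OF xP x(2)]
    define X where "X u = G x u - f u" for u
    have X: "linear X" unfolding X_def by (intro linear_compose_sub G_lin xP f)
    have X_entry: "\<bar>representation C (X v) w\<bar> \<le> r" if vw: "v \<in> B" "w \<in> C" for v w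
    proof -
      have "representation C (X v) w = x (v, w) - x0 (v, w)"
        using rep_coords[OF vw, of "G x"] rep_coords[OF vw, of f] G_coords[OF xP]
        by (simp add: X_def linear_diff[OF linear_representation[OF C(1)]] x0_def)
      moreover have "x (v, w) \<in> {x0 (v, w) - r<..<x0 (v, w) + r}"
        using x(1) vw unfolding coord_box_def PiE_iff by blast
      ultimately show ?thesis by (auto simp: abs_le_iff)
    qed
    have X_rep: "\<bar>representation C (X q) w\<bar> \<le> (\<Sum>v\<in>B. \<bar>representation B q v\<bar>) * r"
      if "w \<in> C" for q w
    proof -
      have "\<bar>representation C (X q) w\<bar> \<le> (\<Sum>v\<in>B. \<bar>representation B q v * representation C (X v) w\<bar>)"
        by (subst linear_representation_image[OF B C(1) X]) (rule sum_abs)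
      also have "\<dots> \<le> (\<Sum>v\<in>B. \<bar>representation B q v\<bar> * r)"
        unfolding abs_mult using that by (intro sum_mono mult_left_mono X_entry) auto
      finally show ?thesis by (simp add: sum_distrib_right)
    qed
    have mX: "\<bar>m (X q)\<bar> \<le> r * \<mu> * (\<Sum>v\<in>B. \<bar>representation B q v\<bar>)" for q
    proof -
      have "\<bar>m (X q)\<bar> \<le> (\<Sum>w\<in>C. \<bar>representation C (X q) w * m w\<bar>)"
        by (subst linear_eq_sum_representation[OF C m]) (simp add: sum_abs)
      also have "\<dots> \<le> (\<Sum>w\<in>C. (\<Sum>v\<in>B. \<bar>representation B q v\<bar>) * r * \<bar>m w\<bar>)"
        unfolding abs_mult by (intro sum_mono mult_right_mono X_rep) auto
      also have "\<dots> = r * \<mu> * (\<Sum>v\<in>B. \<bar>representation B q v\<bar>)"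
        by (simp only: \<mu>_def flip: sum_distrib_left) (simp only: mult_ac)
      finally show ?thesis .
    qed
    define z where "z = inv (G x) (X a)"
    have z_rep: "\<bar>representation B z v\<bar> \<le> real ?n * (\<alpha> * r * M)" if v: "v \<in> B" for v
    proof -
      have quot: "\<bar>K (v, w) x / F x\<bar> \<le> M" if "w \<in> C" for w
        using M[of "(v, w)"] x(2) v that by (simp add: field_simps)
      have "\<bar>representation B z v\<bar> \<le>
          (\<Sum>w\<in>C. \<bar>representation C (X a) w * representation B (inv (G x) w) v\<bar>)"
        unfolding z_def using cr
        by (subst linear_representation_image[OF C B(1)]) (auto intro: sum_abs)
      also have "\<dots> \<le> (\<Sum>w\<in>C. \<alpha> * r * M)"
        unfolding abs_mult \<alpha>_def using cr quot v r
        by (intro sum_mono mult_mono X_rep) (auto intro: sum_nonneg)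
      finally show ?thesis using card by simp
    qed
    have z_sum: "(\<Sum>v\<in>B. \<bar>representation B z v\<bar>) \<le> real ?n * (real ?n * (\<alpha> * r * M))"
      using sum_bounded_above[of B "\<lambda>v. \<bar>representation B z v\<bar>", OF z_rep] by simp
    have "h x - m (f a) = m (X z) - m (X a)"
    proof -
      \<comment> \<open>From \<open>G x u = f a\<close> follow \<open>u = a - z\<close> and
        \<open>f u = f a - X u\<close>. Substituting the first into the second puts two factors
        \<open>X\<close> around a single inverse, whence the factor \<open>r\<close> twice.\<close>
      define u where "u = inv (G x) (f a)"
      have Gu: "G x u = f a" using cr by (simp add: u_def bij_is_surj surj_f_inv_f)
      have "z = inv (G x) (G x a) - u"
        unfolding z_def u_def X_def using cr by (simp add: linear_diff)
      then have u: "u = a - z" using cr by (simp add: bij_is_inj)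
      have "h x - m (f a) = - m (X u)"
        by (simp add: h_def u_def[symmetric] X_def Gu linear_diff[OF m])
      also have "\<dots> = m (X z) - m (X a)" by (simp add: u linear_diff[OF X] linear_diff[OF m])
      finally show ?thesis .
    qed
    then have "\<bar>h x - m (f a)\<bar> \<le> \<bar>m (X a)\<bar> + \<bar>m (X z)\<bar>" by linarith
    also have "\<dots> \<le> r * \<mu> * \<alpha> + r * \<mu> * (\<Sum>v\<in>B. \<bar>representation B z v\<bar>)"
      unfolding \<alpha>_def by (intro add_mono mX)
    also have "\<dots> \<le> r * \<mu> * \<alpha> + r * \<mu> * (real ?n * (real ?n * (\<alpha> * r * M)))"
      using z_sum r \<mu>0 by (intro add_left_mono mult_left_mono) auto
    finally show ?thesis .
  qed

  \<comment> \<open>Density one of the sets of small deviation\<close>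
  have density: "density_one ?I {x \<in> D. \<bar>h x - m (f a)\<bar> < \<epsilon>} x0" if \<epsilon>: "\<epsilon> > 0" for \<epsilon>
  proof -
    define S where "S = {x \<in> D. \<bar>h x - m (f a)\<bar> < \<epsilon>}"
    \<comment> \<open>\<open>\<delta>\<close> and \<open>r0\<close> make each summand of
      \<open>estimate\<close> less than \<open>\<epsilon> / 2\<close>; the \<open>+ 1\<close> keeps
      the denominators positive.\<close>
    define \<delta> where "\<delta> = \<epsilon> / (2 * (\<mu> * (real ?n * (real ?n * \<alpha>)) + 1))"
    define r0 where "r0 = \<epsilon> / (2 * (\<mu> * \<alpha> + 1))"
    have \<mu>\<alpha>: "0 \<le> \<mu> * \<alpha>" "0 \<le> \<mu> * (real ?n * (real ?n * \<alpha>))" using \<alpha>0 \<mu>0 by auto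
    have \<delta>: "\<delta> > 0" and r0: "r0 > 0"
      using \<epsilon> \<mu>\<alpha> by (auto simp: \<delta>_def r0_def intro!: divide_pos_pos)
    have "S = {x \<in> space ?P. F x \<noteq> 0 \<and> \<bar>H x - m (f a)\<bar> < \<epsilon>}"
      using hH by (auto simp: S_def D_eq)
    then have S_sets: "S \<in> sets ?P" by simp
    have "density_one ?I S x0"
    proof (rule density_oneI[OF finI S_sets r0, where c = "real (card ?I) * 2 ^ card ?I / \<delta>"])
      fix r assume r: "0 < r" "r < r0"
      \<comment> \<open>This choice cancels both factors \<open>r\<close> in the second summand of
        \<open>estimate\<close>, and \<open>2 / M\<close> still contributes \<open>r\<^sup>2\<close>
        to the measure bound.\<close>
      define M where "M = \<delta> / r\<^sup>2"
      have M: "M > 0" using \<delta> r by (simp add: M_def)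
      let ?Z = "{x \<in> space ?P. F x = 0}"
      let ?L = "\<lambda>p. {x \<in> coord_box ?I x0 r. M * \<bar>F x\<bar> < \<bar>K p x\<bar>}"
      have box_sub: "coord_box ?I x0 r \<subseteq> space ?P"
        using sets.sets_into_space[OF sets_coord_box[OF finI]] .
      have L_sets: "?L p \<in> sets ?P" if "p \<in> ?I" for p
      proof -
        note [measurable] = K_meas[OF that]
        have "?L p = coord_box ?I x0 r \<inter> {x \<in> space ?P. M * \<bar>F x\<bar> < \<bar>K p x\<bar>}"
          using box_sub by auto
        also have "\<dots> \<in> sets ?P" by (intro sets.Int sets_coord_box finI) measurable
        finally show ?thesis .
      qed
      \<comment> \<open>A bad point is either singular or has a cofactor exceeding \<open>M\<close>
        times the determinant; otherwise \<open>estimate\<close> applies.\<close>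
      have "coord_ball ?I x0 r - S \<subseteq> ?Z \<union> (\<Union>p\<in>?I. ?L p)"
      proof
        fix x assume x: "x \<in> coord_ball ?I x0 r - S"
        then have box: "x \<in> coord_box ?I x0 r" using coord_ball_subset_box[OF finI] by blast
        show "x \<in> ?Z \<union> (\<Union>p\<in>?I. ?L p)"
        proof (rule ccontr)
          assume n: "x \<notin> ?Z \<union> (\<Union>p\<in>?I. ?L p)"
          then have nz: "F x \<noteq> 0" and le: "\<And>p. p \<in> ?I \<Longrightarrow> \<bar>K p x\<bar> \<le> M * \<bar>F x\<bar>"
            using box box_sub by force+
          have "\<bar>h x - m (f a)\<bar> \<le> r * \<mu> * \<alpha> + r * \<mu> * (real ?n * (real ?n * (\<alpha> * r * M)))"
            by (rule estimate[OF box nz le r(1)])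
          also have "\<dots> = r * (\<mu> * \<alpha>) + \<mu> * (real ?n * (real ?n * \<alpha>)) * \<delta>"
            using r by (simp add: M_def power2_eq_square)
          also have "\<dots> \<le> r0 * (\<mu> * \<alpha>) + \<mu> * (real ?n * (real ?n * \<alpha>)) * \<delta>"
            using r \<mu>\<alpha> by (intro add_right_mono mult_right_mono) auto
          also have "\<dots> < \<epsilon> / 2 + \<epsilon> / 2"
          proof (rule add_strict_mono)
            show "r0 * (\<mu> * \<alpha>) < \<epsilon> / 2" using \<epsilon> \<mu>\<alpha>(1) by (simp add: r0_def field_simps)
            have "t * (\<epsilon> / (2 * (t + 1))) < \<epsilon> / 2" if "t \<ge> 0" for t
              using \<epsilon> that by (simp add: field_simps)
            from this[OF \<mu>\<alpha>(2)]
            show "\<mu> * (real ?n * (real ?n * \<alpha>)) * \<delta> < \<epsilon> / 2" unfolding \<delta>_def .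
          qed
          finally have "x \<in> S" using nz box box_sub by (auto simp: S_def D_eq)
          then show False using x by blast
        qed
      qed
      then have "emeasure ?P (coord_ball ?I x0 r - S) \<le> emeasure ?P (?Z \<union> (\<Union>p\<in>?I. ?L p))"
        using L_sets finI by (intro emeasure_mono sets.Un sets.finite_UN) auto
      also have "\<dots> \<le> emeasure ?P ?Z + emeasure ?P (\<Union>p\<in>?I. ?L p)"
        using L_sets finI by (intro emeasure_subadditive sets.finite_UN) auto
      also have "emeasure ?P ?Z = 0"
        using F_ae by (subst (asm) AE_iff_measurable[OF _ refl]) auto
      also have "0 + emeasure ?P (\<Union>p\<in>?I. ?L p) \<le> (\<Sum>p\<in>?I. emeasure ?P (?L p))"
        using L_sets finI by (auto intro!: emeasure_subadditive_finite)
      also have "\<dots> \<le> (\<Sum>p\<in>?I. ennreal ((2 * r) ^ (card ?I - 1) * (2 / M)))"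
        by (intro sum_mono emeasure_affine_quotient_large[OF finI _ M r(1) F_meas K_meas F_upd K_upd])
      also have "\<dots> = ennreal (real (card ?I) * ((2 * r) ^ (card ?I - 1) * (2 / M)))"
        using r M
        by (subst ennreal_mult[of "real (card ?I)"]) (simp_all add: ennreal_of_nat_eq_real_of_nat)
      \<comment> \<open>For \<open>card ?I = 0\<close> both sides vanish through the factor
        \<open>real (card ?I)\<close>; otherwise the exponents \<open>card ?I - 1\<close> and
        \<open>2\<close> of \<open>r\<close> add up to \<open>card ?I + 1\<close>.\<close>
      also have "real (card ?I) * ((2 * r) ^ (card ?I - 1) * (2 / M))
          = real (card ?I) * 2 ^ card ?I / \<delta> * r ^ (card ?I + 1)"
        by (cases "card ?I") (use r \<delta> in \<open>auto simp: M_def power_mult_distrib power2_eq_square\<close>)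
      finally show "emeasure ?P (coord_ball ?I x0 r - S)
          \<le> ennreal (real (card ?I) * 2 ^ card ?I / \<delta> * r ^ (card ?I + 1))" .
    qed
    then show ?thesis by (simp add: S_def)
  qed

  \<comment> \<open>Verification of the approximate limit\<close>
  have "ap_lim ?I D h x0 (m (f a))"
    unfolding ap_lim_def
  proof (intro conjI allI impI density)
    show "D \<in> sets (coord_lebesgue ?I)" using D_sets by (simp add: coord_lebesgue_def)
    have "H \<in> borel_measurable (restrict_space (coord_lebesgue ?I) D)"
      unfolding coord_lebesgue_def by (intro measurable_restrict_space1 measurable_completion H_meas)
    then show "h \<in> borel_measurable (restrict_space (coord_lebesgue ?I) D)"
      by (rule measurable_cong[THEN iffD2, rotated]) (simp add: space_restrict_space hH)
    have "AE x in coord_lebesgue ?I. x \<in> D"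
      unfolding coord_lebesgue_def
    proof (rule AE_completion)
      show "AE x in ?P. x \<in> D" using F_ae AE_space by eventually_elim (simp add: D_eq)
    qed
    \<comment> \<open>The complement of \<open>D\<close> is null globally, so any radius
      serves.\<close>
    then show "\<exists>r>0. AE x in coord_lebesgue ?I. x \<in> coord_ball ?I x0 r \<longrightarrow> x \<in> D"
      by (intro exI[of _ 1]) auto
  qed
  then show ?thesis unfolding D_def h_def G_def x0_def .
qed

theorem theorem3p1:
  fixes f :: "'v::real_vector \<Rightarrow> 'w::real_vector" and l :: "'v \<Rightarrow> real" and b :: 'w
  assumes "\<exists>S :: 'v set. finite S \<and> span S = UNIV"
    and "\<exists>S :: 'w set. finite S \<and> span S = UNIV"
    and "dim (UNIV :: 'v set) = dim (UNIV :: 'w set)"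
    and "linear f"
    and "linear l"
    and "\<forall>x. f x = 0 \<longrightarrow> l x = 0"
    and "b \<in> range f"
  shows "(\<forall>a. f a = b \<longrightarrow> hom_ap_lim {g. linear g \<and> bij g} (\<lambda>g. l (inv g b)) f (l a)) \<and>
    (\<forall>a a'. f a = b \<longrightarrow> f a' = b \<longrightarrow> l a = l a')"
proof -
  have l_cong: "l u = l v" if "f u = f v" for u v
  proof -
    have "f (u - v) = 0" using that by (simp add: linear_diff[OF assms(4)])
    then have "l (u - v) = 0" using assms(6) by blast
    then show ?thesis by (simp add: linear_diff[OF assms(5)])
  qed
  \<comment> \<open>A linear section of \<open>f\<close> over its range turns the functional into
    \<open>m \<circ> f\<close> with \<open>m = l \<circ> s\<close>: \<open>s (f u)\<close> and
    \<open>u\<close> have the same image under \<open>f\<close>, so \<open>l_cong\<close>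
    applies.\<close>
  obtain s where s: "linear s" "\<forall>y\<in>range f. f (s y) = y"
    using linear_exists_right_inverse_on[OF assms(4) subspace_UNIV] by auto
  define m where "m = l \<circ> s"
  have m: "linear m" unfolding m_def by (intro linear_compose s assms)
  have lm: "l u = m (f u)" for u unfolding m_def o_apply by (rule l_cong) (simp add: s)
  have "hom_ap_lim {g. linear g \<and> bij g} (\<lambda>g. l (inv g b)) f (l a)" if "f a = b" for a
    unfolding hom_ap_lim_def
  proof (intro allI impI)
    fix B :: "'v set" and C :: "'w set" assume B: "is_basis B" and C: "is_basis C"
    have "finite B" "finite C" "card B = card C"
      using assms(1,2) is_basis_finite_card[OF B] is_basis_finite_card[OF C] by (auto simp: assms(3))
    then show "ap_lim (B \<times> C) (hom_coords B C ` {g. linear g \<and> bij g})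
        (\<lambda>x. l (inv (the_inv_into {g. linear g} (hom_coords B C) x) b)) (hom_coords B C f) (l a)"
      unfolding lm that[symmetric]
      by (rule hom_ap_lim_at_bases[OF assms(4) m B _ C])
  qed
  then show ?thesis using l_cong by blast
qed

end
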